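(* For all integers $n,T>0$, there exists a principal-agent problem $(\mathbf c,\mathbf F,\mathbf r)$ with $T$ types, $n+1$ actions, and two outcomes that satisfies $$\mathrm{OptLinear}(\mathbf c,\mathbf F,\mathbf r)\ \le\ O\left(\frac{1}{n\log T}\right)\mathrm{Welfare}(\mathbf c,\mathbf F,\mathbf r).$$
   Context: A (typed) principal-agent problem $(\mathbf c,\mathbf F,\mathbf r)$ with $N$ actions, $m$ outcomes and $T$ types consists of: costs $\mathbf c\in\mathbb R_{\ge 0}^N$ (the same for all types) with $0=c_1\le c_2\le\dots\le c_N$; rewards $\mathbf r\in\mathbb R_{\ge0}^m$ with $0=r_1\le\dots\le r_m$; and, for each type $t\in[T]$ and action $i\in[N]$, a probability distribution $(F^{(t)}_{i,j})_{j\in[m]}$ over outcomes. The agent's type is uniform on $[T]$; $\mathbb E_t$ denotes the expectation over it. Let $R^{(t)}_i=\sum_jF^{(t)}_{i,j}r_j$. A contract is a vector $\mathbf x\in\mathbb R_{\ge0}^m$. Under $\mathbf x$, an agent of type $t$ plays an action $i_*^{(t)}(\mathbf x)\in\arg\max_i\big(\sum_j F^{(t)}_{i,j}x_j-c_i\big)$, ties being broken so as to maximize the principal's profit $\mathrm{Profit}^{(t)}(\mathbf x)=\sum_j F^{(t)}_{i_*^{(t)}(\mathbf x),j}(r_j-x_j)$. $\mathrm{Welfare}=\mathbb E_t[\max_i(R^{(t)}_i-c_i)]$ and $\mathrm{OptLinear}=\max_{\alpha\in[0,1]}\mathbb E_t[\mathrm{Profit}^{(t)}(\alpha\mathbf r)]$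 (best linear contract $\mathbf x=\alpha\mathbf r$). The constant hidden in $O$ is absolute. *)

theory Defs
  imports "HOL-Analysis.Analysis"
begin

text \<open>
  Actions, outcomes and types are the indices in \<open>{1..num_actions P}\<close>, \<open>{1..num_outcomes P}\<close> and
  \<open>{1..num_types P}\<close>. Values of the fields outside these ranges are irrelevant.
\<close>

record principal_agent_problem =
  num_actions :: nat
  num_outcomes :: nat
  num_types :: nat
  cost :: "nat \<Rightarrow> real"
  reward :: "nat \<Rightarrow> real"
  outcome_prob :: "nat \<Rightarrow> nat \<Rightarrow> nat \<Rightarrow> real" \<comment> \<open>type, action, outcome\<close>

definition principal_agent :: "principal_agent_problem \<Rightarrow> bool" where
  "principal_agent P \<longleftrightarrow>
     1 \<le> num_actions P \<and> 1 \<le> num_outcomes P \<and> 1 \<le> num_types P \<and>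
     (\<forall>i\<in>{1..num_actions P}. 0 \<le> cost P i) \<and>
     cost P 1 = 0 \<and> mono_on {1..num_actions P} (cost P) \<and>
     (\<forall>j\<in>{1..num_outcomes P}. 0 \<le> reward P j) \<and>
     reward P 1 = 0 \<and> mono_on {1..num_outcomes P} (reward P) \<and>
     (\<forall>t\<in>{1..num_types P}. \<forall>i\<in>{1..num_actions P}.
        (\<forall>j\<in>{1..num_outcomes P}. 0 \<le> outcome_prob P t i j) \<and>
        (\<Sum>j\<in>{1..num_outcomes P}. outcome_prob P t i j) = 1)"

definition expected_reward :: "principal_agent_problem \<Rightarrow> nat \<Rightarrow> nat \<Rightarrow> real" where
  "expected_reward P t i = (\<Sum>j\<in>{1..num_outcomes P}. outcome_prob P t i j * reward P j)"

definition agent_utility :: "principal_agent_problem \<Rightarrow> (nat \<Rightarrow> real) \<Rightarrow> nat \<Rightarrow> nat \<Rightarrow> real" where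
  "agent_utility P x t i = (\<Sum>j\<in>{1..num_outcomes P}. outcome_prob P t i j * x j) - cost P i"

definition principal_utility :: "principal_agent_problem \<Rightarrow> (nat \<Rightarrow> real) \<Rightarrow> nat \<Rightarrow> nat \<Rightarrow> real" where
  "principal_utility P x t i =
     (\<Sum>j\<in>{1..num_outcomes P}. outcome_prob P t i j * (reward P j - x j))"

definition best_responses :: "principal_agent_problem \<Rightarrow> (nat \<Rightarrow> real) \<Rightarrow> nat \<Rightarrow> nat set" where
  "best_responses P x t =
     {i \<in> {1..num_actions P}. \<forall>k\<in>{1..num_actions P}. agent_utility P x t k \<le> agent_utility P x t i}"

definition chosen_action :: "principal_agent_problem \<Rightarrow> (nat \<Rightarrow> real) \<Rightarrow> nat \<Rightarrow> nat" where
  "chosen_action P x t = arg_max_on (principal_utility P x t) (best_responses P x t)"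

definition profit :: "principal_agent_problem \<Rightarrow> (nat \<Rightarrow> real) \<Rightarrow> nat \<Rightarrow> real" where
  "profit P x t = principal_utility P x t (chosen_action P x t)"

definition type_expectation :: "principal_agent_problem \<Rightarrow> (nat \<Rightarrow> real) \<Rightarrow> real" where
  "type_expectation P f = (\<Sum>t\<in>{1..num_types P}. f t) / real (num_types P)"

definition welfare :: "principal_agent_problem \<Rightarrow> real" where
  "welfare P =
     type_expectation P (\<lambda>t. Max ((\<lambda>i. expected_reward P t i - cost P i) ` {1..num_actions P}))"

definition linear_contract :: "principal_agent_problem \<Rightarrow> real \<Rightarrow> nat \<Rightarrow> real" where
  "linear_contract P \<alpha> j = \<alpha> * reward P j"

text \<open>The supremum is a maximum, see \<open>opt_linear_attained\<close> below.\<close>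

definition opt_linear :: "principal_agent_problem \<Rightarrow> real" where
  "opt_linear P = (SUP \<alpha>\<in>{0..1}. type_expectation P (profit P (linear_contract P \<alpha>)))"

lemma best_responses_nonempty:
  assumes "principal_agent P"
  shows "best_responses P x t \<noteq> {}"
proof -
  have "finite {1..num_actions P}" "{1..num_actions P} \<noteq> {}"
    using assms by (auto simp: principal_agent_def)
  then have "Max (agent_utility P x t ` {1..num_actions P}) \<in> agent_utility P x t ` {1..num_actions P}"
    by (intro Max_in) auto
  then obtain i where i: "i \<in> {1..num_actions P}"
    "agent_utility P x t i = Max (agent_utility P x t ` {1..num_actions P})" by auto
  then have "i \<in> best_responses P x t" by (auto simp: best_responses_def)
  then show ?thesis by blast
qed

lemma chosen_action:
  assumes "principal_agent P"
  shows "chosen_action P x t \<in> best_responses P x t"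
    and "i \<in> best_responses P x t \<Longrightarrow> principal_utility P x t i \<le> profit P x t"
proof -
  let ?B = "best_responses P x t" and ?u = "principal_utility P x t"
  have fin: "finite ?B" by (simp add: best_responses_def)
  have "Max (?u ` ?B) \<in> ?u ` ?B"
    using fin best_responses_nonempty[OF assms] by (intro Max_in) auto
  then obtain b where b: "b \<in> ?B" "?u b = Max (?u ` ?B)" by auto
  have "is_arg_max ?u (\<lambda>i. i \<in> ?B) b"
    using b fin by (auto simp: is_arg_max_linorder)
  then have "is_arg_max ?u (\<lambda>i. i \<in> ?B) (chosen_action P x t)"
    unfolding chosen_action_def arg_max_on_def arg_max_def by (rule someI)
  then show "chosen_action P x t \<in> ?B" "i \<in> ?B \<Longrightarrow> ?u i \<le> profit P x t"
    by (auto simp: is_arg_max_linorder profit_def)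
qed

lemma opt_linear_attained:
  assumes P: "principal_agent P"
  obtains \<alpha> where "\<alpha> \<in> {0..1}"
    "opt_linear P = type_expectation P (profit P (linear_contract P \<alpha>))"
    "\<And>\<beta>. \<beta> \<in> {0..1} \<Longrightarrow> type_expectation P (profit P (linear_contract P \<beta>))
        \<le> type_expectation P (profit P (linear_contract P \<alpha>))"
proof -
  let ?T = "{1..num_types P}" and ?N = "{1..num_actions P}"
  define g where "g \<alpha> = type_expectation P (profit P (linear_contract P \<alpha>))" for \<alpha>
  define S where "S = PiE ?T (\<lambda>_. ?N)"
  define A where "A f = {\<alpha> \<in> {0..1}. \<forall>t\<in>?T. \<forall>k\<in>?N.
    agent_utility P (linear_contract P \<alpha>) t k \<le> agent_utility P (linear_contract P \<alpha>) t (f t)}"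
    for f :: "nat \<Rightarrow> nat"
  define h where "h f \<alpha> = type_expectation P (\<lambda>t. principal_utility P (linear_contract P \<alpha>) t (f t))"
    for f :: "nat \<Rightarrow> nat" and \<alpha>
  have finS: "finite S" unfolding S_def by (intro finite_PiE) auto
  have cont: "continuous_on (A f) (h f)" for f
    unfolding h_def type_expectation_def principal_utility_def linear_contract_def
    by (intro continuous_intros) (use P in \<open>auto simp: principal_agent_def\<close>)
  have comp: "compact (A f)" for f
  proof -
    define D where "D = (\<Inter>t\<in>?T. \<Inter>k\<in>?N. {\<alpha>.
      agent_utility P (linear_contract P \<alpha>) t k \<le> agent_utility P (linear_contract P \<alpha>) t (f t)})"
    have "continuous_on UNIV (\<lambda>\<alpha>. agent_utility P (linear_contract P \<alpha>) t k)" for t k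
      unfolding agent_utility_def linear_contract_def by (intro continuous_intros)
    then have "closed D"
      unfolding D_def by (intro closed_INT ballI closed_Collect_le)
    moreover have "A f = {0..1} \<inter> D"
      unfolding A_def D_def by blast
    ultimately show ?thesis
      using compact_Int_closed[OF compact_Icc] by simp
  qed
  have le: "h f \<alpha> \<le> g \<alpha>" if "f \<in> S" "\<alpha> \<in> A f" for f \<alpha>
    unfolding h_def g_def type_expectation_def
    using that
    by (intro divide_right_mono sum_mono chosen_action(2)[OF P])
      (auto simp: A_def S_def best_responses_def PiE_iff)
  have ex: "\<exists>f\<in>S. \<alpha> \<in> A f \<and> g \<alpha> = h f \<alpha>" if "\<alpha> \<in> {0..1}" for \<alpha>
  proof -
    let ?f = "restrict (chosen_action P (linear_contract P \<alpha>)) ?T"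
    have br: "chosen_action P (linear_contract P \<alpha>) t \<in> best_responses P (linear_contract P \<alpha>) t" for t
      by (rule chosen_action(1)[OF P])
    then have "chosen_action P (linear_contract P \<alpha>) t \<in> ?N" for t
      unfolding best_responses_def by blast
    then have "?f \<in> S"
      unfolding S_def by (rule restrict_PiE_iff[THEN iffD2, rule_format])
    moreover have "\<alpha> \<in> A ?f"
      using br that unfolding A_def best_responses_def by simp
    moreover have "g \<alpha> = h ?f \<alpha>"
      by (simp add: g_def h_def type_expectation_def profit_def)
    ultimately show ?thesis by blast
  qed
  define S' where "S' = {f \<in> S. A f \<noteq> {}}"
  have "\<exists>m\<in>A f. \<forall>\<beta>\<in>A f. h f \<beta> \<le> h f m" if "f \<in> S'" for f
    using continuous_attains_sup[OF comp _ cont] that unfolding S'_def by blast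
  then obtain m where m: "\<And>f. f \<in> S' \<Longrightarrow> m f \<in> A f" "\<And>f \<beta>. f \<in> S' \<Longrightarrow> \<beta> \<in> A f \<Longrightarrow> h f \<beta> \<le> h f (m f)"
    by metis
  have "finite S'" "S' \<noteq> {}" using finS ex[of 0] by (auto simp: S'_def)
  then have "Max ((\<lambda>f. h f (m f)) ` S') \<in> (\<lambda>f. h f (m f)) ` S'" by (intro Max_in) auto
  then obtain f where f: "f \<in> S'" "h f (m f) = Max ((\<lambda>f. h f (m f)) ` S')" by auto
  have max: "h f' (m f') \<le> h f (m f)" if "f' \<in> S'" for f'
    using that f \<open>finite S'\<close> by simp
  have in01: "m f \<in> {0..1}" using m(1)[OF f(1)] by (simp add: A_def)
  have bound: "g \<beta> \<le> g (m f)" if \<beta>: "\<beta> \<in> {0..1}" for \<beta>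
  proof -
    obtain f' where f': "f' \<in> S" "\<beta> \<in> A f'" "g \<beta> = h f' \<beta>" using ex[OF \<beta>] by blast
    then have "f' \<in> S'" by (auto simp: S'_def)
    then have "g \<beta> \<le> h f (m f)" using m(2)[of f' \<beta>] max[of f'] f' by linarith
    also have "\<dots> \<le> g (m f)" using le[of f "m f"] m(1) f by (simp add: S'_def)
    finally show ?thesis .
  qed
  have "opt_linear P = g (m f)"
    unfolding opt_linear_def g_def[symmetric]
    by (rule cSup_eq_maximum) (use in01 bound in auto)
  then show ?thesis using that[OF in01] bound by (simp add: g_def)
qed

end

theory Submission
  imports Defs
begin

text \<open>
  Write \<open>\<beta> = 1 - \<alpha>\<close> and index actions by \<open>a = 0, \<dots>, n\<close>. With \<open>K = T + 1\<close>, let action \<open>a\<close> cost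
  \<open>K ^ a - 1\<close> and let it have welfare \<open>a / t\<close> for type \<open>t\<close>. The welfare then adds up to
  \<open>n \<cdot> (1 + 1/2 + \<dots> + 1/T)\<close> over the types. Type \<open>t\<close> prefers \<open>a\<close> to \<open>a - 1\<close> only if
  \<open>\<beta> K ^ a \<le> 2 / t\<close>, and it then yields a profit of at most \<open>2 \<beta> K ^ a\<close>. So the types choosing the
  largest action \<open>A\<close> chosen by anyone number at most \<open>2 / (\<beta> K ^ A)\<close> and yield \<open>O(1)\<close> in total. Each
  of the other types yields less by a factor of \<open>K > T\<close>, hence they too yield \<open>O(1)\<close> in total. Thus no
  linear contract extracts more than \<open>O(1)\<close>, summed over the types.
\<close>

text \<open>This is the counting argument in abstract form: \<open>a t\<close> is the level chosen
  by type \<open>t\<close> and \<beta> is the principal's share. The top level and all lower levels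
  together contribute at most \<open>B\<close> each.\<close>

lemma sum_geometric_levels_le:
  fixes a :: "nat \<Rightarrow> nat" and \<beta> K :: real
  assumes \<beta>: "0 \<le> \<beta>" and K: "1 \<le> K" "real T \<le> K"
    and a: "\<And>t. t \<in> {1..T} \<Longrightarrow> 0 < a t \<Longrightarrow> real t * (\<beta> * K ^ a t) \<le> B" and B: "0 \<le> B"
  shows "(\<Sum>t\<in>{1..T}. \<beta> * (K ^ a t - 1)) \<le> 2 * B"
proof (cases "\<forall>t\<in>{1..T}. a t = 0")
  case True
  then show ?thesis using B by simp
next
  case False
  define A where "A = Max (a ` {1..T})"
  define M where "M = {t \<in> {1..T}. a t = A}"
  \<comment> \<open>The largest type on the top level gives the strongest instance of the hypothesis
    on \<open>a\<close>, and it also bounds the size of \<open>M\<close>, since types are positive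
    integers.\<close>
  define s where "s = Max M"
  have le_A: "a t \<le> A" if "t \<in> {1..T}" for t
    unfolding A_def using that by (intro Max_ge) auto
  have "A \<in> a ` {1..T}"
    unfolding A_def using False by (intro Max_in) auto
  then have "M \<noteq> {}" by (auto simp: M_def)
  moreover have "finite M" by (simp add: M_def)
  ultimately have "s \<in> M" unfolding s_def by (intro Max_in)
  then have s: "s \<in> {1..T}" "a s = A" by (auto simp: M_def)
  have "0 < A" using False le_A by fastforce
  then have top: "real s * (\<beta> * K ^ A) \<le> B" using a[of s] s by simp
  have "M \<subseteq> {1..s}"
    unfolding s_def using \<open>finite M\<close> by (auto simp: M_def intro!: Max_ge)
  then have card_M: "card M \<le> s"
    using card_mono[of "{1..s}" M] by simp
  have pos: "0 \<le> \<beta> * K ^ A" using \<beta> K by simp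
  have "(\<Sum>t\<in>M. \<beta> * (K ^ a t - 1)) \<le> (\<Sum>t\<in>M. \<beta> * K ^ A)"
    using \<beta> by (intro sum_mono mult_left_mono) (auto simp: M_def)
  also have "\<dots> = real (card M) * (\<beta> * K ^ A)" by simp
  also have "\<dots> \<le> real s * (\<beta> * K ^ A)"
    using card_M pos by (intro mult_right_mono) auto
  finally have sum_M: "(\<Sum>t\<in>M. \<beta> * (K ^ a t - 1)) \<le> B" using top by linarith
  \<comment> \<open>Below the top level each type loses a factor \<open>K\<close>. There are at most
    \<open>T \<le> K\<close> such types, so together they contribute no more than \<beta>
    \<open>K ^ A\<close>.\<close>
  have "(\<Sum>t\<in>{1..T} - M. \<beta> * (K ^ a t - 1)) \<le> (\<Sum>t\<in>{1..T} - M. \<beta> * K ^ (A - 1))"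
  proof (intro sum_mono mult_left_mono \<beta>)
    fix t assume t: "t \<in> {1..T} - M"
    then have "a t \<le> A - 1" using le_A[of t] by (auto simp: M_def)
    then have "K ^ a t \<le> K ^ (A - 1)" using K by (intro power_increasing) auto
    then show "K ^ a t - 1 \<le> K ^ (A - 1)" by simp
  qed
  also have "\<dots> = real (card ({1..T} - M)) * (\<beta> * K ^ (A - 1))" by simp
  also have "\<dots> \<le> K * (\<beta> * K ^ (A - 1))"
  proof (intro mult_right_mono)
    have "card ({1..T} - M) \<le> T" using card_mono[of "{1..T}" "{1..T} - M"] by simp
    then show "real (card ({1..T} - M)) \<le> K" using K by linarith
  qed (use \<beta> K in simp)
  also have "\<dots> = \<beta> * K ^ A" using \<open>0 < A\<close> by (cases A) auto
  also have "\<dots> \<le> real s * (\<beta> * K ^ A)"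
    using s pos mult_right_mono[of 1 "real s" "\<beta> * K ^ A"] by simp
  finally have "(\<Sum>t\<in>{1..T} - M. \<beta> * (K ^ a t - 1)) \<le> B" using top by linarith
  moreover have "(\<Sum>t\<in>{1..T}. \<beta> * (K ^ a t - 1))
      = (\<Sum>t\<in>{1..T} - M. \<beta> * (K ^ a t - 1)) + (\<Sum>t\<in>M. \<beta> * (K ^ a t - 1))"
    by (rule sum.subset_diff) (auto simp: M_def)
  ultimately show ?thesis using sum_M by linarith
qed

definition instance_cost :: "nat \<Rightarrow> nat \<Rightarrow> real" where
  "instance_cost T a = (real T + 1) ^ a - 1"

definition instance_return :: "nat \<Rightarrow> nat \<Rightarrow> nat \<Rightarrow> real" where
  "instance_return T t a = instance_cost T a + real a / real t"

text \<open>The only positive reward. It is at least every return with \<open>1 \<le> t\<close> and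
  \<open>a \<le> n\<close>, so that dividing a return by it gives a probability.\<close>

definition instance_reward :: "nat \<Rightarrow> nat \<Rightarrow> real" where
  "instance_reward n T = instance_cost T n + real n"

text \<open>Actions are numbered from 1, so action \<open>i\<close> has level \<open>i - 1\<close>.
  The second outcome's probability is scaled so that the expected reward equals
  \<open>instance_return\<close>.\<close>

definition hard_instance :: "nat \<Rightarrow> nat \<Rightarrow> principal_agent_problem" where
  "hard_instance n T = \<lparr>
     num_actions = n + 1, num_outcomes = 2, num_types = T,
     cost = (\<lambda>i. instance_cost T (i - 1)),
     reward = (\<lambda>j. if j = 1 then 0 else instance_reward n T),
     outcome_prob = (\<lambda>t i j.
       if j = 1 then 1 - instance_return T t (i - 1) / instance_reward n T
       else instance_return T t (i - 1) / instance_reward n T)\<rparr>"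

lemma hard_instance_simps [simp]:
  "num_actions (hard_instance n T) = n + 1"
  "num_outcomes (hard_instance n T) = 2"
  "num_types (hard_instance n T) = T"
  "cost (hard_instance n T) i = instance_cost T (i - 1)"
  by (simp_all add: hard_instance_def)

lemma instance_cost_mono: "a \<le> b \<Longrightarrow> instance_cost T a \<le> instance_cost T b"
  by (simp add: instance_cost_def power_increasing)

lemma instance_cost_0 [simp]: "instance_cost T 0 = 0"
  by (simp add: instance_cost_def)

lemma instance_cost_nonneg [simp]: "0 \<le> instance_cost T a"
  using instance_cost_mono[of 0 a T] by simp

lemma instance_return_nonneg [simp]: "0 \<le> instance_return T t a"
  by (simp add: instance_return_def)

lemma instance_return_le_reward:
  assumes "1 \<le> t" "a \<le> n"
  shows "instance_return T t a \<le> instance_reward n T"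
proof -
  have "real a / real t \<le> real n"
    using assms frac_le[of "real n" "real a" 1 "real t"] by simp
  then show ?thesis
    using instance_cost_mono[OF assms(2), of T] by (simp add: instance_return_def instance_reward_def)
qed

lemma instance_reward_pos: "0 < n \<Longrightarrow> 0 < instance_reward n T"
  using instance_cost_nonneg[of T n] by (simp add: instance_reward_def del: instance_cost_nonneg)

lemma atLeastAtMost_1_2: "{Suc 0..2} = {1, 2}"
  by auto

lemma principal_agent_hard_instance:
  assumes "0 < n" "0 < T"
  shows "principal_agent (hard_instance n T)"
proof -
  have "instance_return T t (i - 1) / instance_reward n T \<le> 1" if "1 \<le> t" "i \<le> n + 1" for t i
    using instance_return_le_reward[of t "i - 1" n T] instance_reward_pos[OF assms(1), of T] that
    by simp
  then show ?thesis
    using assms instance_reward_pos[OF assms(1), of T]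
    unfolding principal_agent_def hard_instance_def
    by (auto simp: mono_on_def atLeastAtMost_1_2 intro!: instance_cost_mono)
qed

lemma expected_reward_hard_instance:
  assumes "0 < n"
  shows "expected_reward (hard_instance n T) t i = instance_return T t (i - 1)"
  using instance_reward_pos[OF assms, of T]
  by (simp add: expected_reward_def hard_instance_def atLeastAtMost_1_2)

lemma agent_utility_linear_contract:
  "agent_utility P (linear_contract P \<alpha>) t i = \<alpha> * expected_reward P t i - cost P i"
  by (simp add: agent_utility_def linear_contract_def expected_reward_def sum_distrib_left mult.left_commute)

lemma principal_utility_linear_contract:
  "principal_utility P (linear_contract P \<alpha>) t i = (1 - \<alpha>) * expected_reward P t i"
  by (simp add: principal_utility_def linear_contract_def expected_reward_def sum_distrib_left
      algebra_simps)

text \<open>By Bernoulli the cost of level \<open>a\<close> is at least \<open>a * T\<close>, which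
  dominates the welfare \<open>a / t\<close>. Profit can thus be bounded through the cost, which
  vanishes at level 0.\<close>

lemma instance_return_le:
  assumes "1 \<le> t" "0 < T"
  shows "instance_return T t a \<le> 2 * instance_cost T a"
proof -
  have "1 + real a * real T \<le> (1 + real T) ^ a"
    using Bernoulli_inequality[of "real T" a] by simp
  moreover have "real a / real t \<le> real a * real T"
  proof -
    have "real a / real t \<le> real a"
      using assms frac_le[of "real a" "real a" 1 "real t"] by simp
    also have "\<dots> \<le> real a * real T"
      using assms mult_left_mono[of 1 "real T" "real a"] by simp
    finally show ?thesis .
  qed
  ultimately show ?thesis by (simp add: instance_return_def instance_cost_def add.commute)
qed

lemma incentive_constraint:
  fixes \<alpha> :: real
  assumes t: "1 \<le> t" and T: "0 < T" and \<alpha>: "\<alpha> \<le> 1"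
    and br: "\<alpha> * instance_return T t a - instance_cost T a
      \<le> \<alpha> * instance_return T t (Suc a) - instance_cost T (Suc a)"
  shows "real t * ((1 - \<alpha>) * (real T + 1) ^ Suc a) \<le> 2"
proof -
  let ?K = "real T + 1"
  \<comment> \<open>The cost increment between adjacent levels. It is at least half of the new power
    because the base \<open>T + 1\<close> is at least 2, and this is the source of the constant
    2.\<close>
  define d where "d = ?K ^ Suc a - ?K ^ a"
  have "?K ^ Suc a = 2 * d - (real T - 1) * ?K ^ a"
    by (simp add: d_def algebra_simps)
  then have d: "?K ^ Suc a \<le> 2 * d" using T by simp
  \<comment> \<open>The return grows by \<open>d + 1 / t\<close> from level \<open>a\<close> to
    \<open>Suc a\<close>, so the share \<alpha> of this growth must cover the cost
    \<open>d\<close>.\<close>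
  have "(1 - \<alpha>) * (d + 1 / real t) \<le> 1 / real t"
    using br by (simp add: instance_return_def instance_cost_def d_def add_divide_distrib diff_divide_distrib algebra_simps
        del: power_Suc)
  moreover have "0 \<le> (1 - \<alpha>) * (1 / real t)" using \<alpha> by simp
  ultimately have "(1 - \<alpha>) * d \<le> 1 / real t" by (simp only: distrib_left)
  then have "real t * ((1 - \<alpha>) * d) \<le> 1" using t by (simp add: field_simps)
  moreover have "real t * ((1 - \<alpha>) * ?K ^ Suc a) \<le> real t * ((1 - \<alpha>) * (2 * d))"
    using d \<alpha> by (intro mult_left_mono) auto
  ultimately show ?thesis by simp
qed

lemma linear_profit_hard_instance_le:
  assumes n: "0 < n" and T: "0 < T" and \<alpha>: "\<alpha> \<in> {0..1}"
  shows "(\<Sum>t\<in>{1..T}. profit (hard_instance n T) (linear_contract (hard_instance n T) \<alpha>) t) \<le> 8"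
proof -
  let ?P = "hard_instance n T"
  define i where "i = chosen_action ?P (linear_contract ?P \<alpha>)"
  have i: "i t \<in> best_responses ?P (linear_contract ?P \<alpha>) t" for t
    unfolding i_def by (rule chosen_action(1)[OF principal_agent_hard_instance[OF n T]])
  have "(\<Sum>t\<in>{1..T}. profit ?P (linear_contract ?P \<alpha>) t)
      \<le> (\<Sum>t\<in>{1..T}. 2 * ((1 - \<alpha>) * ((real T + 1) ^ (i t - 1) - 1)))"
  proof (rule sum_mono)
    fix t assume "t \<in> {1..T}"
    then have "(1 - \<alpha>) * instance_return T t (i t - 1) \<le> (1 - \<alpha>) * (2 * instance_cost T (i t - 1))"
      using \<alpha> T by (intro mult_left_mono instance_return_le) auto
    then show "profit ?P (linear_contract ?P \<alpha>) t \<le> 2 * ((1 - \<alpha>) * ((real T + 1) ^ (i t - 1) - 1))"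
      unfolding profit_def principal_utility_linear_contract expected_reward_hard_instance[OF n]
      by (simp add: i_def instance_cost_def mult.left_commute)
  qed
  also have "\<dots> = 2 * (\<Sum>t\<in>{1..T}. (1 - \<alpha>) * ((real T + 1) ^ (i t - 1) - 1))"
    by (simp only: sum_distrib_left)
  \<comment> \<open>One 2 compares return with cost, one comes from
    \<open>sum_geometric_levels_le\<close>, and the last is the bound \<open>B\<close> from
    \<open>incentive_constraint\<close>.\<close>
  also have "\<dots> \<le> 2 * (2 * 2)"
  proof (intro mult_left_mono sum_geometric_levels_le)
    fix t assume t: "t \<in> {1..T}" and pos: "0 < i t - 1"
    \<comment> \<open>A positive level leaves room for a deviation to the action just below,
      \<open>Suc b\<close>, whose level is \<open>b\<close>.\<close>
    from pos have "i t = Suc (Suc (i t - 2))" by linarith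
    then obtain b where b: "i t = Suc (Suc b)" by blast
    have "agent_utility ?P (linear_contract ?P \<alpha>) t (Suc b)
        \<le> agent_utility ?P (linear_contract ?P \<alpha>) t (i t)"
      using i[of t] b by (auto simp: best_responses_def)
    then show "real t * ((1 - \<alpha>) * (real T + 1) ^ (i t - 1)) \<le> 2"
      unfolding b diff_Suc_1
      using t T \<alpha>
      by (intro incentive_constraint)
        (auto simp: agent_utility_linear_contract expected_reward_hard_instance[OF n] b)
  qed (use \<alpha> in auto)
  finally show ?thesis by simp
qed

lemma opt_linear_hard_instance_le:
  assumes n: "0 < n" and T: "0 < T"
  shows "opt_linear (hard_instance n T) \<le> 8 / real T"
  unfolding opt_linear_def type_expectation_def hard_instance_simps
  by (intro cSUP_least divide_right_mono linear_profit_hard_instance_le n T) auto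

text \<open>The top action \<open>n + 1\<close> alone yields welfare \<open>n / t\<close> for type
  \<open>t\<close>, and these values sum to a multiple of the harmonic number.\<close>

lemma welfare_hard_instance_ge:
  assumes n: "0 < n"
  shows "real n * harm T / real T \<le> welfare (hard_instance n T)"
proof -
  let ?P = "hard_instance n T"
  have "real n * harm T = (\<Sum>t\<in>{1..T}. real n / real t)"
    by (simp add: harm_def sum_distrib_left divide_inverse)
  also have "\<dots> \<le> (\<Sum>t\<in>{1..T}.
      Max ((\<lambda>i. expected_reward ?P t i - cost ?P i) ` {1..num_actions ?P}))"
  proof (rule sum_mono)
    fix t
    have "real n / real t = expected_reward ?P t (n + 1) - cost ?P (n + 1)"
      by (simp add: expected_reward_hard_instance[OF n] instance_return_def)
    then show "real n / real t
        \<le> Max ((\<lambda>i. expected_reward ?P t i - cost ?P i) ` {1..num_actions ?P})"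
      by (simp only:) (intro Max_ge finite_imageI imageI, auto)
  qed
  finally show ?thesis
    unfolding welfare_def type_expectation_def hard_instance_simps
    by (rule divide_right_mono) simp
qed

text \<open>The maximum with 1 keeps the denominator of the final bound positive at
  \<open>T = 1\<close>, where the logarithm vanishes. The harmonic number dominates both terms,
  since its first summand is 1.\<close>

lemma max_1_ln_le_harm:
  assumes "0 < T"
  shows "max 1 (ln (real T)) \<le> harm T"
proof -
  have "ln (real T) \<le> ln (real T + 1)" using assms by simp
  also have "\<dots> \<le> harm T" by (rule ln_le_harm)
  finally have "ln (real T) \<le> harm T" .
  moreover have "harm 1 \<le> (harm T :: real)" using assms by (intro harm_mono) auto
  ultimately show ?thesis by (simp add: harm_expand)
qed

theorem theorem6:
  shows "\<exists>C>0. \<forall>n T. 0 < n \<longrightarrow> 0 < T \<longrightarrow>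
    (\<exists>P. principal_agent P \<and>
         num_types P = T \<and> num_actions P = n + 1 \<and> num_outcomes P = 2 \<and>
         welfare P > 0 \<and>
         opt_linear P \<le> C * (1 / (real n * max 1 (ln (real T)))) * welfare P)"
proof (intro exI[of _ 8] conjI allI impI)
  fix n T :: nat assume n: "0 < n" and T: "0 < T"
  let ?L = "max 1 (ln (real T))" and ?W = "welfare (hard_instance n T)"
  have pos: "0 < real n * ?L" using n by simp
  have "real n * ?L / real T \<le> real n * harm T / real T"
    using max_1_ln_le_harm[OF T] by (intro divide_right_mono mult_left_mono) auto
  also have "\<dots> \<le> ?W" by (rule welfare_hard_instance_ge[OF n])
  finally have W: "real n * ?L / real T \<le> ?W" .
  have "0 < real n * ?L / real T" using pos T by simp
  then have "0 < ?W" using W by linarith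
  moreover have "opt_linear (hard_instance n T) \<le> 8 * (1 / (real n * ?L)) * ?W"
  proof -
    \<comment> \<open>Profit and welfare are averages over the same \<open>T\<close> types, so the
      factor \<open>1 / T\<close> cancels in their ratio.\<close>
    have "8 / real T = 8 * (1 / (real n * ?L)) * (real n * ?L / real T)"
      using n T by (simp add: field_simps)
    also have "\<dots> \<le> 8 * (1 / (real n * ?L)) * ?W"
      using W pos by (intro mult_left_mono) auto
    finally show ?thesis using opt_linear_hard_instance_le[OF n T] by linarith
  qed
  ultimately show "\<exists>P. principal_agent P \<and>
         num_types P = T \<and> num_actions P = n + 1 \<and> num_outcomes P = 2 \<and>
         welfare P > 0 \<and>
         opt_linear P \<le> 8 * (1 / (real n * ?L)) * welfare P"
    using principal_agent_hard_instance[OF n T]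
    by (intro exI[of _ "hard_instance n T"]) simp
qed simp

end
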